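(* Let $(A_m)_{m\ge 0}$ be a sequence of real numbers such that $\sum_{m\ge 0}\frac{A_m}{m!}x^m$ converges for every real $x$, and put $f(x)=e^{-x}\sum_{m=0}^{\infty}\frac{A_m}{m!}x^m$. Then for all $R>0$ and all integers $n\ge 1$, \[ |A_n-f(R)|\le n!\,\frac{e^R}{R^n}\,E(f';R), \] and for $R=n$, $|A_n-f(n)|\le 2\sqrt n\,E(f';n)$ for all $n\ge1$.
   Context: $\Delta A_m=A_{m+1}-A_m$, and $E(f';r)=e^{-r}\sum_{m=0}^\infty\frac{|\Delta A_m|}{m!}r^m$ for $r\ge0$. *)

theory Defs
  imports Complex_Main
begin

definition fwd_diff :: "(nat \<Rightarrow> real) \<Rightarrow> nat \<Rightarrow> real" where
  "fwd_diff A m = A (Suc m) - A m"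

definition borel_fun :: "(nat \<Rightarrow> real) \<Rightarrow> real \<Rightarrow> real" where
  "borel_fun A x = exp (- x) * (\<Sum>m. A m / fact m * x ^ m)"

text \<open>
  The quantity written \<open>E(f';r)\<close> for \<open>f = borel_fun A\<close>: the derivative \<open>f'\<close> is
  \<open>borel_fun (fwd_diff A)\<close>, and its coefficients are replaced by their absolute values.
  When the series of \<open>f\<close> converges on the whole real line, so does the series below.
\<close>

definition E_deriv :: "(nat \<Rightarrow> real) \<Rightarrow> real \<Rightarrow> real" where
  "E_deriv A r = exp (- r) * (\<Sum>m. \<bar>fwd_diff A m\<bar> / fact m * r ^ m)"

end

(* Write w m = R^m / m!, so that exp R * (A n - f(R)) is the sum over m of w m * (A n - A m).
   Bounding A n - A m by the differences between n and m and summing over m first, the theorem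
   reduces to bounding the Poisson tails on the far side of k from n (w 0 + ... + w k if k < n,
   and w (k+1) + w (k+2) + ... if k \<ge> n) by C * w k.

   The constant C = exp R / w n comes from the log-concavity w m * w n \<le> w k * w (m + n - k) for
   k between m and n.  For R = n, the identity j * w j = n * w (j-1) makes the sum of
   |n - j| * w j over a tail telescope to at most n * w k.  The terms of the tail with
   |n - j| \<le> K are at most K in number and at most w k each, so the tail is at most
   (K + n / (K + 1)) * w k; take K = floor (sqrt n). *)

theory Submission
  imports Defs
begin

section \<open>Reduction to bounds on the tails of the exponential series\<close>

lemma abs_diff_le_sum_fwd_diff:
  assumes "a \<le> b"
  shows "\<bar>A b - A a\<bar> \<le> (\<Sum>k\<in>{a..<b}. \<bar>fwd_diff A k\<bar>)"
proof -
  have "A b - A a = (\<Sum>k\<in>{a..<b}. fwd_diff A k)"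
    unfolding fwd_diff_def using sum_Suc_diff'[OF assms, of A] by simp
  then show ?thesis by (metis sum_abs)
qed

text \<open>Interchange of two finite sums: a fixed \<open>\<bar>fwd_diff A k\<bar>\<close> enters
  the bound for \<open>\<bar>A n - A m\<bar>\<close> exactly when \<open>m\<close> lies on the other
  side of the step from \<open>k\<close> to \<open>Suc k\<close> than \<open>n\<close>, so its total
  weight is one of the two tails.\<close>

lemma sum_abs_diff_le_tails:
  fixes w :: "nat \<Rightarrow> real"
  assumes w: "\<And>m. w m \<ge> 0"
    and lower: "\<And>k. k < n \<Longrightarrow> sum w {..k} \<le> C * w k"
    and upper: "\<And>k. n \<le> k \<Longrightarrow> sum w {k<..M} \<le> C * w k"
    and "n \<le> M"
  shows "(\<Sum>m\<le>M. w m * \<bar>A n - A m\<bar>) \<le> C * (\<Sum>k<M. \<bar>fwd_diff A k\<bar> * w k)"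
proof -
  \<comment> \<open>\<open>P m k\<close> says that the step from \<open>k\<close> to
    \<open>Suc k\<close> lies on the way between \<open>m\<close> and \<open>n\<close>. Fixing
    \<open>m\<close> gives the range of a telescoping sum; fixing \<open>k\<close> gives a
    tail.\<close>
  define P where "P m k \<longleftrightarrow> (m \<le> k \<and> k < n) \<or> (n \<le> k \<and> k < m)" for m k
  have between: "\<bar>A n - A m\<bar> \<le> (\<Sum>k<M. if P m k then \<bar>fwd_diff A k\<bar> else 0)" if "m \<le> M" for m
  proof (cases "m \<le> n")
    case True
    have "{k\<in>{..<M}. P m k} = {m..<n}" using True \<open>n \<le> M\<close> by (auto simp: P_def)
    then show ?thesis
      using abs_diff_le_sum_fwd_diff[OF True, of A] by (simp add: sum.inter_filter[symmetric])
  next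
    case False
    then have "n \<le> m" by simp
    have "{k\<in>{..<M}. P m k} = {n..<m}" using False that by (auto simp: P_def)
    then show ?thesis
      using abs_diff_le_sum_fwd_diff[OF \<open>n \<le> m\<close>, of A]
      by (simp add: sum.inter_filter[symmetric] abs_minus_commute)
  qed
  have tail: "(\<Sum>m\<le>M. if P m k then w m else 0) \<le> C * w k" if "k < M" for k
  proof (cases "k < n")
    case True
    have "{m\<in>{..M}. P m k} = {..k}" using True \<open>n \<le> M\<close> by (auto simp: P_def)
    then show ?thesis using lower[OF True] by (simp add: sum.inter_filter[symmetric])
  next
    case False
    have "{m\<in>{..M}. P m k} = {k<..M}" using False by (auto simp: P_def)
    then show ?thesis using upper[of k] False by (simp add: sum.inter_filter[symmetric])
  qed
  have "(\<Sum>m\<le>M. w m * \<bar>A n - A m\<bar>)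
      \<le> (\<Sum>m\<le>M. w m * (\<Sum>k<M. if P m k then \<bar>fwd_diff A k\<bar> else 0))"
    by (intro sum_mono mult_left_mono between w) auto
  also have "\<dots> = (\<Sum>m\<le>M. \<Sum>k<M. \<bar>fwd_diff A k\<bar> * (if P m k then w m else 0))"
    unfolding sum_distrib_left by (intro sum.cong refl) auto
  also have "\<dots> = (\<Sum>k<M. \<bar>fwd_diff A k\<bar> * (\<Sum>m\<le>M. if P m k then w m else 0))"
    unfolding sum_distrib_left by (rule sum.swap)
  also have "\<dots> \<le> (\<Sum>k<M. \<bar>fwd_diff A k\<bar> * (C * w k))"
    by (intro sum_mono mult_left_mono tail) auto
  also have "\<dots> = C * (\<Sum>k<M. \<bar>fwd_diff A k\<bar> * w k)"
    by (simp add: sum_distrib_left mult_ac)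
  finally show ?thesis .
qed

text \<open>Termwise differentiation shifts \<open>A m / fact m\<close> to
  \<open>A (Suc m) / fact m\<close> and keeps convergence on the whole line. Convergence at
  \<open>\<bar>R\<bar> + 1\<close> then forces absolute convergence at \<open>R\<close>.\<close>

lemma summable_abs_fwd_diff:
  fixes A :: "nat \<Rightarrow> real"
  assumes "\<And>x::real. summable (\<lambda>m. A m / fact m * x ^ m)"
  shows "summable (\<lambda>m. \<bar>fwd_diff A m\<bar> / fact m * R ^ m)"
proof -
  have "diffs (\<lambda>m. A m / fact m) m = A (Suc m) / fact m" for m
    by (simp add: diffs_def field_simps del: of_nat_Suc)
  then have "summable (\<lambda>m. A (Suc m) / fact m * x ^ m)" for x :: real
    using termdiff_converges_all[of "\<lambda>m. A m / fact m" x] assms by simp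
  then have "summable (\<lambda>m. fwd_diff A m / fact m * x ^ m)" for x :: real
    using summable_diff[of "\<lambda>m. A (Suc m) / fact m * x ^ m" "\<lambda>m. A m / fact m * x ^ m"] assms
    by (simp add: fwd_diff_def diff_divide_distrib left_diff_distrib)
  then have "summable (\<lambda>m. norm (fwd_diff A m / fact m * R ^ m))"
    by (rule powser_insidea[where x = "\<bar>R\<bar> + 1"]) simp
  then have "summable (\<lambda>m. norm (\<bar>fwd_diff A m\<bar> / fact m * R ^ m))"
    by (simp add: abs_mult)
  then show ?thesis by (rule summable_norm_cancel)
qed

text \<open>After multiplication by \<open>exp R\<close>, the left side is the limit of the partial
  sums of \<open>w m * (A n - A m)\<close>, and the finite bound passes to the limit. Since the
  upper tail is cut at an arbitrary \<open>M\<close>, no infinite sums are interchanged.\<close>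

lemma borel_fun_diff_le:
  fixes A :: "nat \<Rightarrow> real"
  assumes A: "\<And>x::real. summable (\<lambda>m. A m / fact m * x ^ m)"
    and "R > 0"
    and lower: "\<And>k. k < n \<Longrightarrow> (\<Sum>j\<le>k. R ^ j / fact j) \<le> C * (R ^ k / fact k)"
    and upper: "\<And>k M. n \<le> k \<Longrightarrow> (\<Sum>j\<in>{k<..M}. R ^ j / fact j) \<le> C * (R ^ k / fact k)"
  shows "\<bar>A n - borel_fun A R\<bar> \<le> C * E_deriv A R"
proof -
  define w where "w m = R ^ m / fact m" for m
  define S where "S = (\<Sum>m. A m / fact m * R ^ m)"
  define D where "D = (\<Sum>m. \<bar>fwd_diff A m\<bar> / fact m * R ^ m)"
  have w: "w m \<ge> 0" for m using \<open>R > 0\<close> by (simp add: w_def)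
  have "w sums exp R"
    unfolding w_def using exp_converges[of R] by (simp add: divide_inverse mult.commute)
  moreover have "(\<lambda>m. A m * w m) sums S"
    using summable_sums[OF A[of R]] by (simp add: S_def w_def)
  ultimately have "(\<lambda>m. A n * w m - A m * w m) sums (A n * exp R - S)"
    by (intro sums_diff sums_mult)
  then have lim_diff: "(\<lambda>M. \<Sum>m\<le>M. w m * (A n - A m)) \<longlonglongrightarrow> A n * exp R - S"
    by (simp add: sums_def_le algebra_simps)
  have "(\<lambda>k. \<bar>fwd_diff A k\<bar> * w k) sums D"
    using summable_sums[OF summable_abs_fwd_diff[OF A, of R]] by (simp add: D_def w_def)
  then have lim_D: "(\<lambda>M. C * (\<Sum>k<M. \<bar>fwd_diff A k\<bar> * w k)) \<longlonglongrightarrow> C * D"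
    by (intro tendsto_intros) (simp add: sums_def)
  have "\<bar>\<Sum>m\<le>M. w m * (A n - A m)\<bar> \<le> C * (\<Sum>k<M. \<bar>fwd_diff A k\<bar> * w k)" if "n \<le> M" for M
  proof -
    have "\<bar>\<Sum>m\<le>M. w m * (A n - A m)\<bar> \<le> (\<Sum>m\<le>M. w m * \<bar>A n - A m\<bar>)"
      using sum_abs[of "\<lambda>m. w m * (A n - A m)" "{..M}"] w by (simp add: abs_mult)
    also have "\<dots> \<le> C * (\<Sum>k<M. \<bar>fwd_diff A k\<bar> * w k)"
      by (rule sum_abs_diff_le_tails[OF w _ _ that]) (use lower upper in \<open>auto simp: w_def\<close>)
    finally show ?thesis .
  qed
  then have "\<bar>A n * exp R - S\<bar> \<le> C * D"
    by (intro LIMSEQ_le[OF tendsto_rabs[OF lim_diff] lim_D]) auto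
  then have "exp (- R) * \<bar>A n * exp R - S\<bar> \<le> exp (- R) * (C * D)"
    by simp
  moreover have "exp (- R) * \<bar>A n * exp R - S\<bar> = \<bar>exp (- R) * (A n * exp R - S)\<bar>"
    by (simp add: abs_mult)
  moreover have "exp (- R) * (A n * exp R - S) = A n - borel_fun A R"
    by (simp add: borel_fun_def S_def right_diff_distrib exp_minus)
  ultimately show ?thesis by (simp add: E_deriv_def D_def mult_ac)
qed

section \<open>Log-concavity and the bound for arbitrary R\<close>

text \<open>Log-concavity of \<open>1 / fact m\<close> with denominators cleared. Raising
  \<open>e\<close> by one multiplies the left side by \<open>a + e + 1\<close> and the right side by
  the larger or equal \<open>a + d + e + 1\<close>.\<close>

lemma fact_mult_le:
  "fact (a + e) * fact (a + d) \<le> (fact a * fact (a + d + e) :: 'a :: linordered_semidom)"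
proof (induction e)
  case (Suc e)
  have "fact (a + Suc e) * fact (a + d) = of_nat (a + e + 1) * (fact (a + e) * fact (a + d) :: 'a)"
    by (simp add: algebra_simps)
  also have "\<dots> \<le> of_nat (a + d + e + 1) * (fact a * fact (a + d + e))"
    by (intro mult_mono Suc) (auto simp del: of_nat_add simp: of_nat_mono)
  also have "\<dots> = fact a * fact (a + d + Suc e)"
    by (simp add: algebra_simps)
  finally show ?case .
qed simp

text \<open>Both sides carry the same power of \<open>R\<close>, so only the factorials have to be
  compared.\<close>

lemma exp_term_log_concave:
  fixes R :: real
  assumes "R > 0" and "m \<le> k \<and> k \<le> n \<or> n \<le> k \<and> k \<le> m"
  shows "(R ^ m / fact m) * (R ^ n / fact n)
    \<le> (R ^ k / fact k) * (R ^ (m + n - k) / fact (m + n - k))"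
proof -
  have *: "(R ^ a / fact a) * (R ^ b / fact b)
      \<le> (R ^ k / fact k) * (R ^ (a + b - k) / fact (a + b - k))" if "a \<le> k" "k \<le> b" for a b
  proof -
    obtain d e where k: "k = a + d" and b: "b = k + e"
      using \<open>a \<le> k\<close> \<open>k \<le> b\<close> le_Suc_ex by blast
    have diff: "a + b - k = a + e" by (simp add: b)
    have "fact (a + e) * fact k \<le> (fact a * fact b :: real)"
      unfolding b k by (rule fact_mult_le)
    then have "R ^ (a + b) / (fact a * fact b) \<le> R ^ (a + b) / (fact (a + e) * fact k)"
      using \<open>R > 0\<close> by (intro divide_left_mono) auto
    moreover have "a + b = k + (a + e)" by (simp add: b)
    ultimately show ?thesis unfolding diff
      by (metis mult.commute power_add times_divide_times_eq)
  qed
  from assms(2) show ?thesis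
  proof
    assume "n \<le> k \<and> k \<le> m"
    then show ?thesis
      using *[of n m] by (simp only: add.commute[of n m] mult.commute[of "R ^ n / fact n"])
  qed (simp only: *)
qed

text \<open>After multiplication by \<open>R ^ n / fact n\<close>, log-concavity replaces each index
  \<open>j\<close> by \<open>j + n - k\<close>. The new indices are distinct, so their terms sum to
  at most \<open>exp R\<close>. Leaving \<open>I\<close> general covers both tails.\<close>

lemma sum_exp_term_le:
  fixes R :: real
  assumes "R > 0" "finite I" "\<And>j. j \<in> I \<Longrightarrow> j \<le> k \<and> k \<le> n \<or> n \<le> k \<and> k \<le> j"
  shows "(\<Sum>j\<in>I. R ^ j / fact j) \<le> fact n * (exp R / R ^ n) * (R ^ k / fact k)"
proof -
  have inj: "inj_on (\<lambda>j. j + n - k) I"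
  proof (rule inj_onI)
    fix i j assume "i \<in> I" "j \<in> I" "i + n - k = j + n - k"
    \<comment> \<open>These inequalities rule out truncation in the natural subtraction.\<close>
    moreover have "k \<le> i + n" "k \<le> j + n"
      using assms(3)[OF \<open>i \<in> I\<close>] assms(3)[OF \<open>j \<in> I\<close>] by auto
    ultimately show "i = j" by arith
  qed
  have exp: "(\<lambda>j. R ^ j / fact j) sums exp R"
    using exp_converges[of R] by (simp add: divide_inverse mult.commute)
  have "(\<Sum>j\<in>I. R ^ j / fact j) * (R ^ n / fact n)
      \<le> (\<Sum>j\<in>I. (R ^ k / fact k) * (R ^ (j + n - k) / fact (j + n - k)))"
    unfolding sum_distrib_right using assms by (intro sum_mono exp_term_log_concave) auto
  also have "\<dots> = (R ^ k / fact k) * (\<Sum>i\<in>(\<lambda>j. j + n - k) ` I. R ^ i / fact i)"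
    by (simp add: sum.reindex[OF inj] sum_distrib_left)
  also have "\<dots> \<le> (R ^ k / fact k) * exp R"
    using assms(1,2) sum_le_suminf[OF sums_summable[OF exp], of "(\<lambda>j. j + n - k) ` I"] sums_unique[OF exp]
    by (intro mult_left_mono) auto
  finally show ?thesis using \<open>R > 0\<close> by (simp add: field_simps)
qed

section \<open>First moments and the square-root bound for R = n\<close>

text \<open>Markov's inequality with \<open>d j\<close> as the distance to \<open>n\<close>: the
  near terms are bounded by counting, the far ones by the first moment divided by
  \<open>K + 1\<close>.\<close>

lemma sum_le_of_first_moment:
  fixes w d :: "nat \<Rightarrow> real"
  assumes "finite I" and w: "\<And>j. j \<in> I \<Longrightarrow> 0 \<le> w j" "\<And>j. j \<in> I \<Longrightarrow> w j \<le> c"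
    and "0 \<le> c" and d: "\<And>j. j \<in> I \<Longrightarrow> 0 \<le> d j"
    and moment: "(\<Sum>j\<in>I. d j * w j) \<le> real n * c"
    and card: "\<And>K. card {j\<in>I. d j < real K + 1} \<le> K"
  shows "sum w I \<le> 2 * sqrt (real n) * c"
proof -
  define K where "K = nat \<lfloor>sqrt (real n)\<rfloor>"
  have K: "real K \<le> sqrt (real n)" "sqrt (real n) \<le> real K + 1"
    unfolding K_def by (auto intro: less_imp_le)
  let ?N = "{j\<in>I. d j < real K + 1}"
  have "sum w ?N \<le> real (card ?N) * c"
    using w by (intro sum_bounded_above) auto
  also have "\<dots> \<le> sqrt (real n) * c"
    using card[of K] K \<open>0 \<le> c\<close> by (intro mult_right_mono) linarith+
  finally have near: "sum w ?N \<le> sqrt (real n) * c" .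
  have "(real K + 1) * sum w (I - ?N) \<le> (\<Sum>j\<in>I - ?N. d j * w j)"
    unfolding sum_distrib_left using w by (intro sum_mono mult_right_mono) auto
  also have "\<dots> \<le> (\<Sum>j\<in>I. d j * w j)"
    using \<open>finite I\<close> w d by (intro sum_mono2) auto
  \<comment> \<open>One of the two roots is absorbed into \<open>K + 1\<close>, which cancels at the
    end.\<close>
  also have "\<dots> \<le> sqrt (real n) * sqrt (real n) * c" using moment by simp
  also have "\<dots> \<le> (real K + 1) * sqrt (real n) * c"
    using K(2) \<open>0 \<le> c\<close> by (intro mult_right_mono) auto
  also have "\<dots> = (real K + 1) * (sqrt (real n) * c)" by (rule mult.assoc)
  finally have "sum w (I - ?N) \<le> sqrt (real n) * c"
    by (rule mult_left_le_imp_le) simp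
  moreover have "sum w I = sum w (I - ?N) + sum w ?N"
    using \<open>finite I\<close> by (intro sum.subset_diff) auto
  ultimately show ?thesis using near by simp
qed

lemma exp_term_Suc:
  "real (Suc j) * (real n ^ Suc j / fact (Suc j)) = real n * (real n ^ j / fact j)"
  by (simp add: field_simps del: of_nat_Suc)

lemma exp_term_Suc_le:
  assumes "n \<le> Suc j"
  shows "real n ^ Suc j / fact (Suc j) \<le> real n ^ j / fact j"
proof -
  have "real (Suc j) * (real n ^ Suc j / fact (Suc j)) \<le> real (Suc j) * (real n ^ j / fact j)"
    unfolding exp_term_Suc using assms by (intro mult_right_mono) auto
  then show ?thesis by (rule mult_left_le_imp_le) simp
qed

lemma exp_term_le_Suc:
  assumes "Suc j \<le> n"
  shows "real n ^ j / fact j \<le> real n ^ Suc j / fact (Suc j)"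
proof -
  have "real n * (real n ^ j / fact j) \<le> real n * (real n ^ Suc j / fact (Suc j))"
    unfolding exp_term_Suc[of j n, symmetric] using assms by (intro mult_right_mono) auto
  then show ?thesis by (rule mult_left_le_imp_le) (use assms in simp)
qed

lemma lower_tail_le_sqrt:
  assumes "k < n"
  shows "(\<Sum>j\<le>k. real n ^ j / fact j) \<le> 2 * sqrt (real n) * (real n ^ k / fact k)"
proof (rule sum_le_of_first_moment[where d = "\<lambda>j. real n - real j"])
  \<comment> \<open>Each summand with \<open>j > 0\<close> is \<open>n\<close> times the difference
    of the terms at \<open>j\<close> and \<open>j - 1\<close>.\<close>
  have "(\<Sum>j\<le>k. (real n - real j) * (real n ^ j / fact j)) = real n * (real n ^ k / fact k)"
  proof (induction k)
    case (Suc k)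
    then show ?case using exp_term_Suc[of k n] by (simp only: sum.atMost_Suc left_diff_distrib)
  qed simp
  then show "(\<Sum>j\<le>k. (real n - real j) * (real n ^ j / fact j)) \<le> real n * (real n ^ k / fact k)"
    by simp
next
  fix j assume "j \<in> {..k}"
  then have "j \<le> k" by simp
  then show "real n ^ j / fact j \<le> real n ^ k / fact k"
    using \<open>k < n\<close>
  proof (induction k rule: dec_induct)
    case (step i)
    then show ?case using exp_term_le_Suc[of i n] by linarith
  qed simp
next
  fix K
  \<comment> \<open>As \<open>k < n\<close>, the distance 0 does not occur, which leaves
    \<open>K\<close> possible distances rather than \<open>K + 1\<close>.\<close>
  have "{j\<in>{..k}. real n - real j < real K + 1} \<subseteq> {n - K..<n}" using assms by auto
  then have "card {j\<in>{..k}. real n - real j < real K + 1} \<le> card {n - K..<n}"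
    by (intro card_mono) auto
  then show "card {j\<in>{..k}. real n - real j < real K + 1} \<le> K" by simp
qed (use assms in auto)

lemma upper_tail_le_sqrt:
  assumes "n \<le> k"
  shows "(\<Sum>j\<in>{k<..M}. real n ^ j / fact j) \<le> 2 * sqrt (real n) * (real n ^ k / fact k)"
proof (rule sum_le_of_first_moment[where d = "\<lambda>j. real j - real n"])
  \<comment> \<open>The endpoint is written \<open>k + l\<close> for the induction; the subtracted
    last term is nonnegative and is dropped afterwards.\<close>
  have "(\<Sum>j\<in>{k<..k + l}. (real j - real n) * (real n ^ j / fact j))
      = real n * (real n ^ k / fact k) - real n * (real n ^ (k + l) / fact (k + l))" for l
  proof (induction l)
    case (Suc l)
    have "{k<..k + Suc l} = insert (Suc (k + l)) {k<..k + l}" by auto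
    then show ?case using exp_term_Suc[of "k + l" n] Suc
      by (simp add: left_diff_distrib diff_divide_distrib del: of_nat_Suc power_Suc fact_Suc)
  qed simp
  moreover have "{k<..M} = {k<..k + (M - k)}" by (cases "k \<le> M") auto
  ultimately show "(\<Sum>j\<in>{k<..M}. (real j - real n) * (real n ^ j / fact j))
      \<le> real n * (real n ^ k / fact k)"
    by simp
next
  fix j assume "j \<in> {k<..M}"
  then have "k \<le> j" by simp
  then show "real n ^ j / fact j \<le> real n ^ k / fact k"
  proof (induction j rule: dec_induct)
    case (step i)
    then show ?case using exp_term_Suc_le[of n i] assms by linarith
  qed simp
next
  fix K
  have "{j\<in>{k<..M}. real j - real n < real K + 1} \<subseteq> {n<..n + K}" using assms by auto
  then have "card {j\<in>{k<..M}. real j - real n < real K + 1} \<le> card {n<..n + K}"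
    by (intro card_mono) auto
  then show "card {j\<in>{k<..M}. real j - real n < real K + 1} \<le> K" by simp
qed (use assms in auto)

theorem theorem7:
  fixes A :: "nat \<Rightarrow> real"
  assumes "\<And>x::real. summable (\<lambda>m. A m / fact m * x ^ m)"
  shows "(\<forall>R::real. \<forall>n::nat. R > 0 \<longrightarrow> n \<ge> 1 \<longrightarrow>
            \<bar>A n - borel_fun A R\<bar> \<le> fact n * (exp R / R ^ n) * E_deriv A R)
       \<and> (\<forall>n::nat. n \<ge> 1 \<longrightarrow>
            \<bar>A n - borel_fun A (real n)\<bar> \<le> 2 * sqrt (real n) * E_deriv A (real n))"
proof (intro conjI allI impI)
  fix R :: real and n :: nat
  assume "R > 0"
  then show "\<bar>A n - borel_fun A R\<bar> \<le> fact n * (exp R / R ^ n) * E_deriv A R"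
    by (intro borel_fun_diff_le assms sum_exp_term_le) auto
next
  fix n :: nat
  assume "n \<ge> 1"
  then show "\<bar>A n - borel_fun A (real n)\<bar> \<le> 2 * sqrt (real n) * E_deriv A (real n)"
    by (intro borel_fun_diff_le assms lower_tail_le_sqrt upper_tail_le_sqrt) auto
qed

end
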